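(* Let $G$ be a $\sigma$-compact locally compact abelian group, $(X,G)$ a topological dynamical system, $m$ a $G$-invariant probability measure on $X$ and $\mathcal{A}=(A_n)$ a Følner sequence in $G$. Assume that $x\in X$ is a Wiener–Wintner point of $(X,G,m)$ with respect to $\mathcal{A}$ and let $B=\{e_\chi:\chi\in\mathbb{S}\}$ be the associated basis of eigenfunctions. Then, for all $f\in C(X)$ and all $\chi\in\widehat{G}$, the Fourier–Bohr coefficient $a_\chi^{\mathcal{A}}(f_x)$ exists and satisfies $$a_\chi^{\mathcal{A}}(f_x)=\begin{cases}\langle f,e_\chi\rangle & \text{if }\chi\in\mathbb{S},\\ 0&\text{if }\chi\notin\mathbb{S}.\end{cases}$$
   Context: $G$ is written additively, with a fixed Haar measure; $|A|$ is the Haar measure of $A\subseteq G$ and $dt$ denotes integration against it. $\widehat{G}$ is the dual group (continuous homomorphisms $G\to\{w\in\mathbb{C}:|w|=1\}$). A Følner sequence is a sequence $(A_n)$ of open relatively compact subsets of $G$ (in particular $|A_n|>0$) with $\lim_n|A_n\triangle(t+A_n)|/|A_n|=0$ for all $t\in G$. A topological dynamical system $(X,G)$ is a compact Hausdorff space $X$ with a continuous action $G\times X\to X$, $(t,x)\mapsto t.x$. Measures on $X$ are regular Borel measures. An eigenfunction to $\chi\in\widehat{G}$ is a nonzero $f\in L^2(X,m)$ with $f(t\,\cdot)=\chi(t)f$ in $L^2(X,m)$ for all $t\in G$; together with $0$ these form the eigenspace of $\chi$. $\mathbb{S}$ is the set of $\chi\in\widehat{G}$ having an eigenfunction (eigenvalues).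 $\langle f,g\rangle=\int_Xf\overline{g}\,dm$. A point $x\in X$ is a Wiener–Wintner point of $(X,G,m)$ with respect to $\mathcal{A}$ if there is a set $B\subseteq\mathcal{L}^2(X,m)$ (square-integrable functions) consisting of eigenfunctions such that: (1) for each $\chi\in\mathbb{S}$ the set of $e\in B$ that are eigenfunctions to $\chi$ is an orthonormal basis of the eigenspace of $\chi$; (2) for all $f\in C(X)$ and $e\in B$ with corresponding eigenvalue $\chi_e$ the limit $\lim_n\frac{1}{|A_n|}\int_{A_n}f(t.x)\overline{\chi_e(t)}\,dt$ exists and equals $\langle f,e\rangle$. $B$ is called the basis associated to $x$. Existence of a Wiener–Wintner point implies that $m$ is ergodic, so each eigenspace is one-dimensional and $B$ is written as $\{e_\chi:\chi\in\mathbb{S}\}$ with $e_\chi$ the unique element of $B$ that is an eigenfunction to $\chi$. For $f\in C(X)$, $f_x(t)=f(t.x)$, and $a_\chi^{\mathcal{A}}(f_x)=\lim_n\frac{1}{|A_n|}\int_{A_n}f(t.x)\overline{\chi(t)}\,dt$, provided the limit exists. *)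

theory Defs
  imports "HOL-Analysis.Analysis" "HOL-Probability.Probability_Measure"
begin

text \<open>Groups and spaces are types. A locally compact abelian group is a type of sort
  \<open>{topological_ab_group_add, t2_space}\<close> whose topology is locally compact; a compact Hausdorff
  space is a type of sort \<open>t2_space\<close> with compact universe.\<close>

definition sigma_compact :: "'a::topological_space set \<Rightarrow> bool" where
  "sigma_compact S \<longleftrightarrow> (\<exists>K :: nat \<Rightarrow> 'a set. (\<forall>n. compact (K n)) \<and> (\<Union>n. K n) = S)"

text \<open>For finite measures on a compact Hausdorff space this is ordinary regularity: inner
  regularity on all Borel sets then follows from outer regularity by taking complements.\<close>

definition radon_measure :: "'a::topological_space measure \<Rightarrow> bool" where
  "radon_measure M \<longleftrightarrow>
     sets M = sets borel \<and>
     (\<forall>K. compact K \<longrightarrow> emeasure M K < \<infinity>) \<and>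
     (\<forall>S \<in> sets borel. emeasure M S = (INF U\<in>{U. open U \<and> S \<subseteq> U}. emeasure M U)) \<and>
     (\<forall>U. open U \<longrightarrow> emeasure M U = (SUP K\<in>{K. compact K \<and> K \<subseteq> U}. emeasure M K))"

definition haar_measure :: "'g::{topological_ab_group_add, t2_space} measure \<Rightarrow> bool" where
  "haar_measure h \<longleftrightarrow>
     radon_measure h \<and> emeasure h UNIV \<noteq> 0 \<and>
     (\<forall>t. \<forall>S \<in> sets borel. emeasure h ((+) t ` S) = emeasure h S)"

definition dual_group :: "('g::{topological_ab_group_add, t2_space} \<Rightarrow> complex) set" where
  "dual_group = {\<xi>. continuous_on UNIV \<xi> \<and> (\<forall>t. cmod (\<xi> t) = 1) \<and>
                    (\<forall>s t. \<xi> (s + t) = \<xi> s * \<xi> t)}"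

definition folner_sequence ::
    "'g::{topological_ab_group_add, t2_space} measure \<Rightarrow> (nat \<Rightarrow> 'g set) \<Rightarrow> bool" where
  "folner_sequence h A \<longleftrightarrow>
     (\<forall>n. open (A n) \<and> compact (closure (A n)) \<and> measure h (A n) > 0) \<and>
     (\<forall>t. (\<lambda>n. measure h ((A n - (+) t ` A n) \<union> ((+) t ` A n - A n)) / measure h (A n))
            \<longlonglongrightarrow> 0)"

definition topological_dynamical_system ::
    "('g::{topological_ab_group_add, t2_space} \<Rightarrow> 'x::t2_space \<Rightarrow> 'x) \<Rightarrow> bool" where
  "topological_dynamical_system act \<longleftrightarrow>
     compact (UNIV :: 'x set) \<and>
     continuous_on UNIV (\<lambda>(t, x). act t x) \<and>
     (\<forall>x. act 0 x = x) \<and> (\<forall>s t x. act (s + t) x = act s (act t x))"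

definition invariant_probability_measure ::
    "('g \<Rightarrow> 'x::t2_space \<Rightarrow> 'x) \<Rightarrow> 'x measure \<Rightarrow> bool" where
  "invariant_probability_measure act m \<longleftrightarrow>
     prob_space m \<and> radon_measure m \<and>
     (\<forall>t. \<forall>S \<in> sets borel. emeasure m (act t -` S) = emeasure m S)"

text \<open>Elements of \<open>L\<^sup>2\<close> are represented by square-integrable functions, and identities in
  \<open>L\<^sup>2\<close> by identities almost everywhere.\<close>

definition square_integrable :: "'x measure \<Rightarrow> ('x \<Rightarrow> complex) \<Rightarrow> bool" where
  "square_integrable m f \<longleftrightarrow> f \<in> borel_measurable m \<and> integrable m (\<lambda>x. (cmod (f x))\<^sup>2)"

definition L2_inner :: "'x measure \<Rightarrow> ('x \<Rightarrow> complex) \<Rightarrow> ('x \<Rightarrow> complex) \<Rightarrow> complex" where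
  "L2_inner m f g = (LINT x|m. f x * cnj (g x))"

definition L2_norm :: "'x measure \<Rightarrow> ('x \<Rightarrow> complex) \<Rightarrow> real" where
  "L2_norm m f = sqrt (LINT x|m. (cmod (f x))\<^sup>2)"

definition eigenspace ::
    "('g \<Rightarrow> 'x \<Rightarrow> 'x) \<Rightarrow> 'x measure \<Rightarrow> ('g \<Rightarrow> complex) \<Rightarrow> ('x \<Rightarrow> complex) set" where
  "eigenspace act m \<xi> =
     {f. square_integrable m f \<and> (\<forall>t. AE x in m. f (act t x) = \<xi> t * f x)}"

definition eigenfunction ::
    "('g \<Rightarrow> 'x \<Rightarrow> 'x) \<Rightarrow> 'x measure \<Rightarrow> ('g \<Rightarrow> complex) \<Rightarrow> ('x \<Rightarrow> complex) \<Rightarrow> bool" where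
  "eigenfunction act m \<xi> f \<longleftrightarrow> f \<in> eigenspace act m \<xi> \<and> \<not> (AE x in m. f x = 0)"

definition eigenvalues ::
    "('g::{topological_ab_group_add, t2_space} \<Rightarrow> 'x \<Rightarrow> 'x) \<Rightarrow> 'x measure
       \<Rightarrow> ('g \<Rightarrow> complex) set" where
  "eigenvalues act m = {\<xi> \<in> dual_group. \<exists>f. eigenfunction act m \<xi> f}"

text \<open>Orthonormality also forces distinct members of \<open>S\<close> to differ in \<open>L\<^sup>2\<close>. The last
  clause says that the linear span of \<open>S\<close> is dense in \<open>E\<close>.\<close>

definition orthonormal_basis ::
    "'x measure \<Rightarrow> ('x \<Rightarrow> complex) set \<Rightarrow> ('x \<Rightarrow> complex) set \<Rightarrow> bool" where
  "orthonormal_basis m E S \<longleftrightarrow>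
     S \<subseteq> E \<and>
     (\<forall>e\<in>S. \<forall>e'\<in>S. L2_inner m e e' = (if e = e' then 1 else 0)) \<and>
     (\<forall>g\<in>E. \<forall>\<delta>>0. \<exists>F c. finite F \<and> F \<subseteq> S \<and>
        L2_norm m (\<lambda>x. g x - (\<Sum>e\<in>F. c e * e x)) < \<delta>)"

definition fourier_bohr_average ::
    "'g measure \<Rightarrow> (nat \<Rightarrow> 'g set) \<Rightarrow> ('g \<Rightarrow> complex) \<Rightarrow> ('g \<Rightarrow> complex) \<Rightarrow> nat \<Rightarrow> complex" where
  "fourier_bohr_average h A \<xi> \<phi> n =
     (1 / measure h (A n)) *\<^sub>R (LINT t:A n|h. \<phi> t * cnj (\<xi> t))"

definition fourier_bohr_exists ::
    "'g measure \<Rightarrow> (nat \<Rightarrow> 'g set) \<Rightarrow> ('g \<Rightarrow> complex) \<Rightarrow> ('g \<Rightarrow> complex) \<Rightarrow> bool" where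
  "fourier_bohr_exists h A \<xi> \<phi> \<longleftrightarrow> convergent (fourier_bohr_average h A \<xi> \<phi>)"

definition fourier_bohr_coefficient ::
    "'g measure \<Rightarrow> (nat \<Rightarrow> 'g set) \<Rightarrow> ('g \<Rightarrow> complex) \<Rightarrow> ('g \<Rightarrow> complex) \<Rightarrow> complex" where
  "fourier_bohr_coefficient h A \<xi> \<phi> = lim (fourier_bohr_average h A \<xi> \<phi>)"

text \<open>\<open>B\<close> witnesses that \<open>x\<close> is a Wiener--Wintner point, i.e. \<open>B\<close> is a basis associated to
  \<open>x\<close>. An eigenfunction, being nonzero, belongs to exactly one eigenvalue, so the
  quantification over \<open>\<xi>\<close> in the last clause is over \<open>\<xi>\<^sub>e\<close> only.\<close>

definition wiener_wintner_basis ::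
    "'g::{topological_ab_group_add, t2_space} measure \<Rightarrow> (nat \<Rightarrow> 'g set) \<Rightarrow>
     ('g \<Rightarrow> 'x::t2_space \<Rightarrow> 'x) \<Rightarrow> 'x measure \<Rightarrow> 'x \<Rightarrow> ('x \<Rightarrow> complex) set \<Rightarrow> bool" where
  "wiener_wintner_basis h A act m x B \<longleftrightarrow>
     (\<forall>e\<in>B. \<exists>\<xi>\<in>eigenvalues act m. eigenfunction act m \<xi> e) \<and>
     (\<forall>\<xi>\<in>eigenvalues act m.
        orthonormal_basis m (eigenspace act m \<xi>) {e\<in>B. eigenfunction act m \<xi> e}) \<and>
     (\<forall>f. continuous_on UNIV f \<longrightarrow>
        (\<forall>e\<in>B. \<forall>\<xi>\<in>eigenvalues act m. eigenfunction act m \<xi> e \<longrightarrow>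
           fourier_bohr_average h A \<xi> (\<lambda>t. f (act t x)) \<longlonglongrightarrow> L2_inner m f e))"

definition wiener_wintner_point ::
    "'g::{topological_ab_group_add, t2_space} measure \<Rightarrow> (nat \<Rightarrow> 'g set) \<Rightarrow>
     ('g \<Rightarrow> 'x::t2_space \<Rightarrow> 'x) \<Rightarrow> 'x measure \<Rightarrow> 'x \<Rightarrow> bool" where
  "wiener_wintner_point h A act m x \<longleftrightarrow> (\<exists>B. wiener_wintner_basis h A act m x B)"

text \<open>\<open>e\<^sub>\<xi>\<close>; it is well defined for an eigenvalue \<open>\<xi>\<close> when \<open>B\<close> is a basis associated to a
  Wiener--Wintner point, since then all eigenspaces are one-dimensional.\<close>

definition basis_eigenfunction ::
    "('g \<Rightarrow> 'x \<Rightarrow> 'x) \<Rightarrow> 'x measure \<Rightarrow> ('x \<Rightarrow> complex) set \<Rightarrow> ('g \<Rightarrow> complex)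
       \<Rightarrow> ('x \<Rightarrow> complex)" where
  "basis_eigenfunction act m B \<xi> = (THE e. e \<in> B \<and> eigenfunction act m \<xi> e)"

end

theory Submission
  imports Defs
begin

text \<open>For an eigenvalue \<open>\<xi>\<close> only the meaning of \<open>e\<^sub>\<xi>\<close> is at stake. Two members \<open>e\<close>, \<open>e'\<close> of
the basis with the same eigenvalue have the same inner product with every continuous \<open>f\<close>, namely
the limit of one and the same sequence of averages. The measure is regular, so the continuous
functions are dense in \<open>L\<^sup>2\<close> (\<open>AE_zero_of_orthogonal_to_continuous\<close>), so \<open>e\<close> and \<open>e'\<close>
agree almost everywhere, and orthonormality gives \<open>e = e'\<close>.

The trivial character is always an eigenvalue. Applied to \<open>f = 1\<close>, the Wiener--Wintner property
gives \<open>\<langle>1, e\<rangle> = 1\<close> for its basis function \<open>e\<close>; as \<open>e\<close> also has norm \<open>1\<close>, it is the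
constant \<open>1\<close>. So \<open>x\<close> is generic for \<open>m\<close>: the averages of a continuous \<open>f\<close> along the orbit
of \<open>x\<close> converge to \<open>\<integral> f dm\<close>.

Now let \<open>\<xi>\<close> be a character that is not an eigenvalue, and let \<open>C\<close> be the set of all continuous
\<open>g\<close> whose \<open>\<xi>\<close>-averages differ from those of \<open>f\<close> by a null sequence. This set is closed under
midpoints, and, by the Folner property, under the twisted translations that send \<open>g\<close> to
\<open>y \<mapsto> cnj (\<xi> t) * g (act t y)\<close>. As in the Hilbert space proof of the mean ergodic theorem, the
element of least norm in the \<open>L\<^sup>2\<close>-closure of \<open>C\<close> is unique, hence fixed by these isometries;
if it were nonzero, it would be an eigenfunction for \<open>\<xi>\<close>
(\<open>eigenfunction_of_positive_distance\<close>). Hence \<open>C\<close> has elements \<open>g\<close> of arbitrarily small norm.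
For these the \<open>\<xi>\<close>-averages of \<open>f\<close> are, up to a null sequence, at most the averages of \<open>\<bar>g\<bar>\<close>,
which converge to \<open>\<integral> \<bar>g\<bar> dm\<close> by genericity, and this is small too.\<close>

section \<open>Square-integrable functions\<close>

lemma square_integrable_add:
  assumes "square_integrable m f" "square_integrable m g"
  shows "square_integrable m (\<lambda>y. f y + g y)"
proof -
  have [measurable]: "f \<in> borel_measurable m" "g \<in> borel_measurable m"
    using assms by (auto simp: square_integrable_def)
  have "(cmod (f y + g y))\<^sup>2 \<le> 2 * (cmod (f y))\<^sup>2 + 2 * (cmod (g y))\<^sup>2" for y
  proof -
    have "(cmod (f y + g y))\<^sup>2 \<le> (cmod (f y) + cmod (g y))\<^sup>2"
      by (intro power_mono norm_triangle_ineq) auto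
    also have "\<dots> \<le> 2 * (cmod (f y))\<^sup>2 + 2 * (cmod (g y))\<^sup>2"
      using sum_squares_bound[of "cmod (f y)" "cmod (g y)"] by (simp add: power2_sum)
    finally show ?thesis .
  qed
  then have "integrable m (\<lambda>y. (cmod (f y + g y))\<^sup>2)"
    using assms unfolding square_integrable_def
    by (elim conjE, intro Bochner_Integration.integrable_bound
          [of m "\<lambda>y. 2 * (cmod (f y))\<^sup>2 + 2 * (cmod (g y))\<^sup>2" "\<lambda>y. (cmod (f y + g y))\<^sup>2"]
          AE_I2 Bochner_Integration.integrable_add) auto
  then show ?thesis by (auto simp: square_integrable_def)
qed

lemma square_integrable_mult_left:
  assumes "square_integrable m f"
  shows "square_integrable m (\<lambda>y. c * f y)"
  using assms by (auto simp: square_integrable_def norm_mult power_mult_distrib)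

lemma square_integrable_diff:
  assumes "square_integrable m f" "square_integrable m g"
  shows "square_integrable m (\<lambda>y. f y - g y)"
  using square_integrable_add[OF assms(1) square_integrable_mult_left[OF assms(2), of "-1"]]
  by simp

lemma L2_parallelogram:
  assumes "square_integrable m f" "square_integrable m g"
  shows "(LINT y|m. (cmod (f y - g y))\<^sup>2) =
    2 * (LINT y|m. (cmod (f y))\<^sup>2) + 2 * (LINT y|m. (cmod (g y))\<^sup>2)
      - 4 * (LINT y|m. (cmod ((f y + g y) / 2))\<^sup>2)"
proof -
  have i: "integrable m (\<lambda>y. (cmod ((f y + g y) / 2))\<^sup>2)"
    using square_integrable_mult_left[OF square_integrable_add[OF assms], of "1/2"]
    by (simp add: square_integrable_def)
  have "(cmod (a - b))\<^sup>2 = 2 * (cmod a)\<^sup>2 + 2 * (cmod b)\<^sup>2 - 4 * (cmod ((a + b) / 2))\<^sup>2"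
    for a b :: complex
    unfolding cmod_power2 by (simp add: power2_eq_square field_simps)
  then show ?thesis
    using assms i by (simp add: square_integrable_def)
qed

text \<open>On a probability space \<open>L\<^sup>1\<close>-norms are controlled by \<open>L\<^sup>2\<close>-norms, so geometric decay in \<open>L\<^sup>2\<close>
makes the sum of the absolute values integrable, hence finite almost everywhere.\<close>

lemma (in prob_space) AE_summable_of_fast_L2:
  fixes u :: "nat \<Rightarrow> 'a \<Rightarrow> complex"
  assumes u: "\<And>k. square_integrable M (u k)"
    and small: "\<And>k. (LINT y|M. (cmod (u k y))\<^sup>2) \<le> c * (1/4) ^ k"
  shows "AE y in M. summable (\<lambda>k. cmod (u k y))"
proof -
  have [measurable]: "u k \<in> borel_measurable M" for k
    using u by (auto simp: square_integrable_def)
  \<comment> \<open>The arithmetic-geometric mean inequality, with the weight \<open>2 ^ k\<close> that turns \<open>(1/4) ^ k\<close> into \<open>(1/2) ^ k\<close> after integration.\<close>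
  have bound: "cmod (u k y) \<le> (2 ^ k * (cmod (u k y))\<^sup>2 + (1/2) ^ k) / 2" for k y
  proof -
    have "0 \<le> (2 ^ k * cmod (u k y) - 1)\<^sup>2 / 2 ^ k" by simp
    also have "\<dots> = 2 ^ k * (cmod (u k y))\<^sup>2 - 2 * cmod (u k y) + (1/2) ^ k"
      by (simp add: power2_eq_square field_simps power_one_over)
    finally show ?thesis by simp
  qed
  have dom: "integrable M (\<lambda>y. (2 ^ k * (cmod (u k y))\<^sup>2 + (1/2) ^ k) / 2)" for k
    using u[of k] by (auto simp: square_integrable_def)
  have int: "integrable M (\<lambda>y. cmod (u k y))" for k
    by (rule Bochner_Integration.integrable_bound[OF dom[of k]])
      (use bound in \<open>auto intro!: AE_I2 order_trans[OF _ abs_ge_self]\<close>)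
  have le: "(LINT y|M. cmod (u k y)) \<le> (\<bar>c\<bar> + 1) * (1/2) ^ k" for k
  proof -
    have "(LINT y|M. cmod (u k y)) \<le> (LINT y|M. (2 ^ k * (cmod (u k y))\<^sup>2 + (1/2) ^ k) / 2)"
      by (intro integral_mono int dom bound)
    also have "\<dots> = (2 ^ k * (LINT y|M. (cmod (u k y))\<^sup>2) + (1/2) ^ k) / 2"
      using u[of k] by (simp add: square_integrable_def prob_space)
    also have "\<dots> \<le> (2 ^ k * (c * (1/4) ^ k) + (1/2) ^ k) / 2"
      using small[of k] by (intro divide_right_mono add_right_mono mult_left_mono) auto
    also have "2 ^ k * (c * (1/4) ^ k) = c * (1/2 :: real) ^ k"
      by (simp add: power_mult_distrib[symmetric] mult.left_commute)
    also have "(c * (1/2) ^ k + (1/2) ^ k) / 2 = (c + 1) / 2 * (1/2) ^ k"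
      by (simp add: field_simps)
    also have "\<dots> \<le> (\<bar>c\<bar> + 1) * (1/2) ^ k"
      by (intro mult_right_mono) auto
    finally show ?thesis .
  qed
  have sum: "summable (\<lambda>k. (\<bar>c\<bar> + 1) * (1/2::real) ^ k)"
    by (intro summable_mult summable_geometric) auto
  have "(\<integral>\<^sup>+y. (\<Sum>k. ennreal (cmod (u k y))) \<partial>M) = (\<Sum>k. \<integral>\<^sup>+y. ennreal (cmod (u k y)) \<partial>M)"
    by (intro nn_integral_suminf) auto
  also have "\<dots> = (\<Sum>k. ennreal (LINT y|M. cmod (u k y)))"
    by (intro suminf_cong nn_integral_eq_integral int) auto
  also have "\<dots> \<le> (\<Sum>k. ennreal ((\<bar>c\<bar> + 1) * (1/2) ^ k))"
    by (intro suminf_le ennreal_leI le) auto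
  also have "\<dots> = ennreal (\<Sum>k. (\<bar>c\<bar> + 1) * (1/2) ^ k)"
    using sum by (intro suminf_ennreal2) auto
  finally have "(\<integral>\<^sup>+y. (\<Sum>k. ennreal (cmod (u k y))) \<partial>M) \<noteq> \<infinity>"
    using ennreal_less_top top.extremum_strict by (metis infinity_ennreal_def leD)
  then have "AE y in M. (\<Sum>k. ennreal (cmod (u k y))) \<noteq> \<infinity>"
    by (intro nn_integral_PInf_AE) auto
  then show ?thesis
    by eventually_elim (auto intro: summable_suminf_not_top)
qed

lemma L2_Fatou:
  fixes v :: "nat \<Rightarrow> 'x \<Rightarrow> complex"
  assumes v: "\<And>k. square_integrable m (v k)" and g: "g \<in> borel_measurable m"
    and lim: "AE y in m. (\<lambda>k. v k y) \<longlonglongrightarrow> g y"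
    and bound: "eventually (\<lambda>k. (LINT y|m. (cmod (v k y))\<^sup>2) \<le> C) sequentially"
  shows "square_integrable m g" "(LINT y|m. (cmod (g y))\<^sup>2) \<le> C"
proof -
  have [measurable]: "v k \<in> borel_measurable m" "g \<in> borel_measurable m" for k
    using v g by (auto simp: square_integrable_def)
  obtain k0 where "(LINT y|m. (cmod (v k0 y))\<^sup>2) \<le> C"
    using bound by (auto simp: eventually_sequentially)
  then have C: "C \<ge> 0"
    using order_trans[OF Bochner_Integration.integral_nonneg] by (metis zero_le_power2)
  have eq: "(\<integral>\<^sup>+y. ennreal ((cmod (v k y))\<^sup>2) \<partial>m) = ennreal (LINT y|m. (cmod (v k y))\<^sup>2)" for k
    using v[of k] by (intro nn_integral_eq_integral) (auto simp: square_integrable_def)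
  have "(\<integral>\<^sup>+y. ennreal ((cmod (g y))\<^sup>2) \<partial>m)
      = (\<integral>\<^sup>+y. liminf (\<lambda>k. ennreal ((cmod (v k y))\<^sup>2)) \<partial>m)"
  proof (rule nn_integral_cong_AE)
    show "AE y in m. ennreal ((cmod (g y))\<^sup>2) = liminf (\<lambda>k. ennreal ((cmod (v k y))\<^sup>2))"
      using lim
    proof eventually_elim
      case (elim y)
      then have "(\<lambda>k. ennreal ((cmod (v k y))\<^sup>2)) \<longlonglongrightarrow> ennreal ((cmod (g y))\<^sup>2)"
        by (intro tendsto_intros)
      then show ?case by (rule lim_imp_Liminf[OF sequentially_bot, symmetric])
    qed
  qed
  also have "\<dots> \<le> liminf (\<lambda>k. \<integral>\<^sup>+y. ennreal ((cmod (v k y))\<^sup>2) \<partial>m)"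
    by (intro nn_integral_liminf) auto
  also have "\<dots> \<le> limsup (\<lambda>k. \<integral>\<^sup>+y. ennreal ((cmod (v k y))\<^sup>2) \<partial>m)"
    by (intro Liminf_le_Limsup) auto
  also have "\<dots> \<le> ennreal C"
    by (intro Limsup_bounded eventually_mono[OF bound]) (auto simp: eq intro: ennreal_leI)
  finally have le: "(\<integral>\<^sup>+y. ennreal ((cmod (g y))\<^sup>2) \<partial>m) \<le> ennreal C" .
  then have int: "integrable m (\<lambda>y. (cmod (g y))\<^sup>2)"
    by (intro integrableI_bounded) (auto simp: le_less_trans[OF _ ennreal_less_top])
  then show "square_integrable m g" by (simp add: square_integrable_def)
  have "ennreal (LINT y|m. (cmod (g y))\<^sup>2) = (\<integral>\<^sup>+y. ennreal ((cmod (g y))\<^sup>2) \<partial>m)"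
    using int by (intro nn_integral_eq_integral[symmetric]) auto
  then show "(LINT y|m. (cmod (g y))\<^sup>2) \<le> C"
    using le C by (metis ennreal_le_iff)
qed

section \<open>Eigenfunctions from elements of least norm\<close>

lemma invariant_distr:
  assumes "invariant_probability_measure act m" "continuous_on UNIV (act t)"
  shows "act t \<in> measurable m m" "distr m m (act t) = m"
proof -
  have sets: "sets m = sets borel"
    using assms by (auto simp: invariant_probability_measure_def radon_measure_def)
  then have sp: "space m = UNIV" using sets_eq_imp_space_eq by force
  have "act t \<in> measurable borel borel"
    using assms by (intro borel_measurable_continuous_onI)
  then show meas: "act t \<in> measurable m m"
    using measurable_cong_sets[OF sets sets] by blast
  show "distr m m (act t) = m"
    by (rule measure_eqI)
      (use assms meas sets in \<open>auto simp: emeasure_distr sp invariant_probability_measure_def\<close>)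
qed

text \<open>A sequence in \<open>C\<close> whose norms approach the infimum is Cauchy by the parallelogram identity, since
midpoints stay in \<open>C\<close>. A twisted translation preserves norms and \<open>C\<close>, so for the same reason it
moves the members of the sequence by less and less, and the limit is fixed by it: this is the
equation of an eigenfunction. The sequence is chosen to approach the infimum so fast that
limits can be taken pointwise almost everywhere, which makes the limit an actual function.\<close>

lemma eigenfunction_of_positive_distance:
  fixes C :: "('x::t2_space \<Rightarrow> complex) set"
  assumes inv: "invariant_probability_measure act m"
    and cont: "\<And>t. continuous_on UNIV (act t)"
    and unimodular: "\<And>t. cmod (\<xi> t) = 1"
    and "C \<noteq> {}" and L2: "\<And>f. f \<in> C \<Longrightarrow> square_integrable m f"
    and mid: "\<And>f g. f \<in> C \<Longrightarrow> g \<in> C \<Longrightarrow> (\<lambda>y. (f y + g y) / 2) \<in> C"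
    and twist: "\<And>f t. f \<in> C \<Longrightarrow> (\<lambda>y. cnj (\<xi> t) * f (act t y)) \<in> C"
    and "d > 0" and pos: "\<And>f. f \<in> C \<Longrightarrow> d \<le> (LINT y|m. (cmod (f y))\<^sup>2)"
  shows "\<exists>g. eigenfunction act m \<xi> g"
proof -
  interpret prob_space m
    using inv by (simp add: invariant_probability_measure_def)
  define E where "E f = (LINT y|m. (cmod (f y))\<^sup>2)" for f :: "'x \<Rightarrow> complex"
  define I where "I = Inf (E ` C)"
  have bdd: "bdd_below (E ` C)" using pos by (auto simp: E_def intro!: bdd_belowI2)
  have I_le: "I \<le> E f" if "f \<in> C" for f
    unfolding I_def using that bdd by (intro cInf_lower) auto
  have I_pos: "d \<le> I"
    unfolding I_def using \<open>C \<noteq> {}\<close> pos by (intro cInf_greatest) (auto simp: E_def)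
  have "\<exists>f\<in>C. E f < I + (1/4) ^ k" for k :: nat
  proof -
    have "Inf (E ` C) < I + (1/4) ^ k" by (simp add: I_def)
    then show ?thesis using cInf_lessD[of "E ` C"] \<open>C \<noteq> {}\<close> by blast
  qed
  then obtain F where FC: "\<And>k. F k \<in> C" and FE: "\<And>k. E (F k) < I + (1/4) ^ k"
    by metis
  \<comment> \<open>The parallelogram identity turns near-minimality into closeness.\<close>
  have par: "E (\<lambda>y. f y - g y) \<le> 2 * (E f - I) + 2 * (E g - I)" if "f \<in> C" "g \<in> C" for f g
    using L2_parallelogram[OF L2 L2, OF that] I_le[OF mid[OF that]] by (simp add: E_def)
  have close: "E (\<lambda>y. F k y - F l y) \<le> 4 * (1/4) ^ min k l" for k l
  proof -
    have "E (\<lambda>y. F k y - F l y) \<le> 2 * (E (F k) - I) + 2 * (E (F l) - I)"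
      by (intro par FC)
    also have "\<dots> \<le> 2 * (1/4) ^ min k l + 2 * (1/4) ^ min k l"
    proof -
      have "E (F j) - I \<le> (1/4) ^ min k l" if "min k l \<le> j" for j
      proof -
        have "(1/4::real) ^ j \<le> (1/4) ^ min k l"
          using that by (intro power_decreasing) auto
        from order_trans[OF less_imp_le[OF FE] add_left_mono[OF this]]
        show ?thesis by (simp only: diff_le_eq add.commute)
      qed
      then show ?thesis by (intro add_mono mult_left_mono) auto
    qed
    finally show ?thesis by simp
  qed
  have [measurable]: "F k \<in> borel_measurable m" for k
    using L2[OF FC] by (simp add: square_integrable_def)
  have summ: "AE y in m. summable (\<lambda>k. cmod (F (Suc k) y - F k y))"
  proof (rule AE_summable_of_fast_L2[where c = 4])
    show "square_integrable m (\<lambda>y. F (Suc k) y - F k y)" for k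
      by (intro square_integrable_diff L2 FC)
    show "(LINT y|m. (cmod (F (Suc k) y - F k y))\<^sup>2) \<le> 4 * (1/4) ^ k" for k
      using close[of "Suc k" k] by (simp add: E_def)
  qed
  define g where "g y = lim (\<lambda>k. F k y)" for y
  have [measurable]: "g \<in> borel_measurable m" unfolding g_def by measurable
  have lim: "AE y in m. (\<lambda>k. F k y) \<longlonglongrightarrow> g y"
    using summ
  proof eventually_elim
    case (elim y)
    then have "summable (\<lambda>k. F (Suc k) y - F k y)" by (rule summable_norm_cancel)
    then have "convergent (\<lambda>k. F k y - F 0 y)"
      by (simp add: summable_iff_convergent sum_lessThan_telescope[of "\<lambda>k. F k y"])
    then have "convergent (\<lambda>k. (F k y - F 0 y) + F 0 y)"
      by (intro convergent_add convergent_const)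
    then have "convergent (\<lambda>k. F k y)" by simp
    then show ?case unfolding g_def by (simp add: convergent_LIMSEQ_iff)
  qed
  have "eventually (\<lambda>k. (LINT y|m. (cmod (F k y))\<^sup>2) \<le> I + 1) sequentially"
  proof (rule always_eventually, rule allI)
    fix k
    have "(1/4::real) ^ k \<le> 1" by (simp add: power_le_one)
    then show "(LINT y|m. (cmod (F k y))\<^sup>2) \<le> I + 1" using FE[of k] by (simp add: E_def)
  qed
  then have gL2: "square_integrable m g"
    by (intro L2_Fatou(1)[OF L2[OF FC] _ lim]) auto
  have nonzero: "\<not> (AE y in m. g y = 0)"
  proof
    \<comment> \<open>If \<open>g\<close> vanished, Fatou's lemma, applied to \<open>F k - F l\<close> as \<open>l\<close> tends to infinity, would make the norm of \<open>F k\<close> itself small.\<close>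
    assume zero: "AE y in m. g y = 0"
    have Ek: "E (F k) \<le> 4 * (1/4) ^ k" for k
      unfolding E_def
    proof (rule L2_Fatou(2)[of m "\<lambda>l y. F k y - F l y"])
      show "square_integrable m (\<lambda>y. F k y - F l y)" for l
        by (intro square_integrable_diff L2 FC)
      show "AE y in m. (\<lambda>l. F k y - F l y) \<longlonglongrightarrow> F k y"
        using lim zero
      proof eventually_elim
        case (elim y)
        then show ?case using tendsto_diff[OF tendsto_const[of "F k y"] elim(1)] by simp
      qed
      show "eventually (\<lambda>l. (LINT y|m. (cmod (F k y - F l y))\<^sup>2) \<le> 4 * (1/4) ^ k) sequentially"
        using eventually_ge_at_top[of k]
      proof eventually_elim
        case (elim l)
        then show ?case using close[of k l] by (simp add: E_def min_absorb1)
      qed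
    qed auto
    have "(\<lambda>k. 4 * (1/4::real) ^ k) \<longlonglongrightarrow> 4 * 0"
      by (intro tendsto_intros LIMSEQ_realpow_zero) auto
    moreover have "d \<le> 4 * (1/4) ^ k" for k
      using Ek[of k] I_le[OF FC[of k]] I_pos by simp
    ultimately have "d \<le> 4 * 0"
      using LIMSEQ_le_const by blast
    then show False using \<open>d > 0\<close> by simp
  qed
  have "AE y in m. g (act t y) = \<xi> t * g y" for t
  proof -
    note T = invariant_distr[OF inv cont, of t]
    note [measurable] = T(1)
    have Tk: "E (\<lambda>y. cnj (\<xi> t) * F k (act t y)) = E (F k)" for k
    proof -
      have "E (\<lambda>y. cnj (\<xi> t) * F k (act t y)) = (LINT y|m. (cmod (F k (act t y)))\<^sup>2)"
        by (simp add: E_def norm_mult unimodular)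
      also have "\<dots> = (LINT y|distr m m (act t). (cmod (F k y))\<^sup>2)"
        by (subst integral_distr) auto
      finally show ?thesis by (simp add: T(2) E_def)
    qed
    \<comment> \<open>The twisted translate of \<open>F k\<close> is as nearly minimal as \<open>F k\<close>, so the two are close.\<close>
    have "AE y in m. summable (\<lambda>k. cmod (cnj (\<xi> t) * F k (act t y) - F k y))"
    proof (rule AE_summable_of_fast_L2[where c = 4])
      show "square_integrable m (\<lambda>y. cnj (\<xi> t) * F k (act t y) - F k y)" for k
        by (intro square_integrable_diff L2 FC twist)
      show "(LINT y|m. (cmod (cnj (\<xi> t) * F k (act t y) - F k y))\<^sup>2) \<le> 4 * (1/4) ^ k" for k
        using par[OF twist[OF FC] FC, of t k k] FE[of k] by (simp add: Tk E_def[symmetric])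
    qed
    moreover have "AE y in m. (\<lambda>k. F k (act t y)) \<longlonglongrightarrow> g (act t y)"
    proof -
      have "AE y in distr m m (act t). (\<lambda>k. F k y) \<longlonglongrightarrow> g y"
        unfolding T(2) by (rule lim)
      then show ?thesis by (rule AE_distrD[OF T(1)])
    qed
    ultimately show ?thesis using lim
    proof eventually_elim
      case (elim y)
      have "(\<lambda>k. cnj (\<xi> t) * F k (act t y) - F k y) \<longlonglongrightarrow> 0"
        by (rule tendsto_norm_zero_cancel) (rule summable_LIMSEQ_zero[OF elim(1)])
      moreover have "(\<lambda>k. cnj (\<xi> t) * F k (act t y) - F k y) \<longlonglongrightarrow> cnj (\<xi> t) * g (act t y) - g y"
        by (intro tendsto_intros elim)
      ultimately have eq: "cnj (\<xi> t) * g (act t y) - g y = 0" using LIMSEQ_unique by metis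
      have one: "\<xi> t * cnj (\<xi> t) = 1"
        using complex_norm_square[of "\<xi> t"] unimodular[of t] by simp
      have "\<xi> t * g y = \<xi> t * (cnj (\<xi> t) * g (act t y))" using eq by simp
      then show ?case by (simp add: mult.assoc[symmetric] one)
    qed
  qed
  then have "eigenfunction act m \<xi> g"
    using gL2 nonzero by (simp add: eigenfunction_def eigenspace_def)
  then show ?thesis by blast
qed

section \<open>Density of the continuous functions\<close>

lemma norm_integral_le_of_norm_le:
  fixes f :: "'a \<Rightarrow> 'b::{banach, second_countable_topology}"
  assumes "integrable M f" "integrable M g" "\<And>x. norm (f x) \<le> g x"
  shows "norm (integral\<^sup>L M f) \<le> integral\<^sup>L M g"
  using assms by (intro order_trans[OF integral_norm_bound integral_mono]) auto

lemma continuous_on_compact_UNIV_bounded: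
  fixes f :: "'x::topological_space \<Rightarrow> complex"
  assumes "compact (UNIV :: 'x set)" "continuous_on UNIV f"
  obtains M where "\<And>y. cmod (f y) \<le> M"
proof -
  have "bounded (range f)"
    using assms by (intro compact_imp_bounded compact_continuous_image)
  then show ?thesis using that by (auto simp: bounded_iff)
qed

lemma continuous_imp_square_integrable:
  fixes f :: "'x::t2_space \<Rightarrow> complex"
  assumes "compact (UNIV :: 'x set)" "continuous_on UNIV f"
    and "prob_space m" "radon_measure m"
  shows "square_integrable m f"
proof -
  interpret prob_space m by fact
  have "sets m = sets borel" using assms by (auto simp: radon_measure_def)
  then have [measurable]: "f \<in> borel_measurable m"
    using borel_measurable_continuous_onI[OF assms(2)] measurable_cong_sets by blast
  obtain M where M: "\<And>y. cmod (f y) \<le> M"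
    using continuous_on_compact_UNIV_bounded[OF assms(1,2)] by blast
  have "integrable m (\<lambda>y. (cmod (f y))\<^sup>2)"
    by (rule integrable_const_bound[where B = "M\<^sup>2"]) (auto intro!: AE_I2 power_mono M)
  then show ?thesis by (simp add: square_integrable_def)
qed

lemma square_integrable_mult_integrable:
  assumes "square_integrable m f" "square_integrable m g"
  shows "integrable m (\<lambda>y. f y * cnj (g y))"
proof (rule Bochner_Integration.integrable_bound)
  have [measurable]: "f \<in> borel_measurable m" "g \<in> borel_measurable m"
    using assms by (auto simp: square_integrable_def)
  show "integrable m (\<lambda>y. (cmod (f y))\<^sup>2 + (cmod (g y))\<^sup>2)"
    using assms by (simp add: square_integrable_def)
  have "(\<lambda>y. cnj (g y)) \<in> borel_measurable m"
    by (rule borel_measurable_continuous_on[of cnj]) (auto intro: continuous_intros)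
  then show "(\<lambda>y. f y * cnj (g y)) \<in> borel_measurable m" by measurable
  have "a * b \<le> a\<^sup>2 + b\<^sup>2" if "0 \<le> a" "0 \<le> b" for a b :: real
    using sum_squares_bound[of a b] mult_nonneg_nonneg[OF that] by linarith
  then show "AE y in m. norm (f y * cnj (g y)) \<le> norm ((cmod (f y))\<^sup>2 + (cmod (g y))\<^sup>2)"
    by (simp add: norm_mult)
qed

lemma radon_measure_outer_open:
  assumes "radon_measure m" "finite_measure m" "S \<in> sets m" "e > 0"
  obtains U where "open U" "S \<subseteq> U" "measure m U < measure m S + e"
proof -
  interpret finite_measure m by fact
  have sets: "sets m = sets borel" using assms by (simp add: radon_measure_def)
  have outer: "(INF U\<in>{U. open U \<and> S \<subseteq> U}. emeasure m U) = emeasure m S"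
    using assms(1,3) unfolding radon_measure_def by metis
  have "emeasure m S < emeasure m S + ennreal e"
    using \<open>e > 0\<close> by (simp add: emeasure_eq_measure ennreal_less_iff flip: ennreal_plus)
  then have "(INF U\<in>{U. open U \<and> S \<subseteq> U}. emeasure m U) < emeasure m S + ennreal e"
    unfolding outer .
  then obtain U where U: "open U" "S \<subseteq> U" "emeasure m U < emeasure m S + ennreal e"
    by (auto simp: INF_less_iff)
  have "measure m U < measure m S + e"
    using U(3) \<open>e > 0\<close> by (simp add: emeasure_eq_measure ennreal_less_iff flip: ennreal_plus)
  then show ?thesis using U that by blast
qed

lemma Urysohn_compact_UNIV:
  fixes S T :: "'x::t2_space set"
  assumes "compact (UNIV :: 'x set)" "closed S" "closed T" "S \<inter> T = {}"
  obtains f :: "'x \<Rightarrow> real"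
  where "continuous_on UNIV f" "\<And>y. f y \<in> {0..1}" "\<And>y. y \<in> S \<Longrightarrow> f y = 0" "\<And>y. y \<in> T \<Longrightarrow> f y = 1"
proof -
  have "Hausdorff_space (euclidean :: 'x topology)"
    unfolding Hausdorff_space_def disjnt_def using hausdorff by (metis open_openin)
  then have "normal_space (euclidean :: 'x topology)"
    using assms(1) by (intro compact_Hausdorff_or_regular_imp_normal_space)
      (auto simp: compact_space_def)
  then obtain f where f: "continuous_map euclidean (top_of_set {0..1::real}) f"
      "f ` S \<subseteq> {0}" "f ` T \<subseteq> {1}"
    using Urysohn_lemma[of euclidean S T 0 1] assms by (auto simp: disjnt_def)
  show ?thesis
    by (rule that[of f]) (use f in \<open>auto simp: continuous_map_in_subtopology image_subset_iff\<close>)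
qed

text \<open>In other words, the continuous functions are dense in \<open>L\<^sup>2\<close>. The integral of \<open>g\<close> over a
measurable \<open>A\<close> vanishes because the indicator of \<open>A\<close> is approximated by Urysohn functions:
regularity puts \<open>A\<close> between a closed set and an open set that differ by a set of small measure,
on which \<open>g\<close>, being square integrable, has a small integral.\<close>

lemma AE_zero_of_orthogonal_to_continuous:
  fixes g :: "'x::t2_space \<Rightarrow> complex"
  assumes comp: "compact (UNIV :: 'x set)" and "prob_space m" and radon: "radon_measure m"
    and g: "square_integrable m g"
    and orth: "\<And>f. continuous_on UNIV f \<Longrightarrow> L2_inner m f g = 0"
  shows "AE y in m. g y = 0"
proof -
  interpret prob_space m by fact
  have sets: "sets m = sets borel" using radon by (simp add: radon_measure_def)
  have sp: "space m = UNIV" using sets_eq_imp_space_eq[OF sets] by simp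
  have [measurable]: "g \<in> borel_measurable m" using g by (simp add: square_integrable_def)
  have sq: "square_integrable m (\<lambda>_. 1)" by (simp add: square_integrable_def)
  have gint: "integrable m (\<lambda>y. cnj (g y))"
    using square_integrable_mult_integrable[OF sq g] by simp
  define N where "N = (LINT y|m. (cmod (g y))\<^sup>2)"
  have "AE y in m. cnj (g y) = 0"
  proof (rule density_zero[OF gint])
    fix A assume A: "A \<in> sets m"
    have small: "cmod (LINT y:A|m. cnj (g y)) \<le> \<eta> * (N / 2 + 1)" if eta: "\<eta> > 0" for \<eta> :: real
    proof -
      obtain U where U: "open U" "A \<subseteq> U" "measure m U < measure m A + \<eta>\<^sup>2"
        by (rule radon_measure_outer_open[OF radon _ A, of "\<eta>\<^sup>2"])
          (use eta finite_measure_axioms in auto)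
      have A': "- A \<in> sets m" using A sets.compl_sets[OF A] by (simp add: sp Compl_eq_Diff_UNIV)
      obtain V where V: "open V" "- A \<subseteq> V" "measure m V < measure m (- A) + \<eta>\<^sup>2"
        by (rule radon_measure_outer_open[OF radon _ A', of "\<eta>\<^sup>2"])
          (use eta finite_measure_axioms in auto)
      have [measurable]: "U \<in> sets m" "V \<in> sets m" "A \<in> sets m"
        using U V A by (auto simp: sets)
      have "measure m (- A) = 1 - measure m A"
        using prob_compl[OF A] by (simp add: sp Compl_eq_Diff_UNIV)
      moreover have "U \<union> V = space m" using U V by (auto simp: sp)
      then have "measure m (U \<inter> V) = measure m U + measure m V - 1"
        using measure_Un3[of U m V] prob_space by (simp add: fmeasurable_eq_sets)
      ultimately have W: "measure m (U \<inter> V) \<le> 2 * \<eta>\<^sup>2" using U(3) V(3) by simp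
      \<comment> \<open>On the complement of \<open>U \<inter> V\<close> the function \<open>f\<close> agrees with the indicator of \<open>A\<close>.\<close>
      obtain f :: "'x \<Rightarrow> real" where f: "continuous_on UNIV f" "\<And>y. f y \<in> {0..1}"
          "\<And>y. y \<in> - U \<Longrightarrow> f y = 0" "\<And>y. y \<in> - V \<Longrightarrow> f y = 1"
      proof (rule Urysohn_compact_UNIV[OF comp, of "- U" "- V"])
        show "- U \<inter> - V = {}" using U V by blast
      qed (use U V in auto)
      have fc: "continuous_on UNIV (\<lambda>y. complex_of_real (f y))"
        by (intro continuous_intros f)
      have fint: "integrable m (\<lambda>y. complex_of_real (f y) * cnj (g y))"
        by (intro square_integrable_mult_integrable g
            continuous_imp_square_integrable[OF comp fc prob_space_axioms radon])
      have Aint: "integrable m (\<lambda>y. indicator A y *\<^sub>R cnj (g y))"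
        using gint A by (rule integrable_mult_indicator[rotated])
      have bound: "norm (indicator A y *\<^sub>R cnj (g y) - complex_of_real (f y) * cnj (g y))
          \<le> \<eta> / 2 * (cmod (g y))\<^sup>2 + 1 / (2 * \<eta>) * indicator (U \<inter> V) y" for y
      proof -
        have "\<bar>indicator A y - f y\<bar> \<le> indicator (U \<inter> V) y"
          using f(2)[of y] f(3)[of y] f(4)[of y] U(2) V(2)
          by (auto split: split_indicator)
        moreover have "norm (indicator A y *\<^sub>R cnj (g y) - complex_of_real (f y) * cnj (g y))
            = \<bar>indicator A y - f y\<bar> * cmod (g y)"
          by (simp add: scaleR_conv_of_real left_diff_distrib[symmetric] norm_mult
              del: of_real_diff flip: of_real_diff)
        ultimately have "norm (indicator A y *\<^sub>R cnj (g y) - complex_of_real (f y) * cnj (g y))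
            \<le> indicator (U \<inter> V) y * cmod (g y)"
          by (simp add: mult_right_mono)
        also have "\<dots> \<le> \<eta> / 2 * (cmod (g y))\<^sup>2 + 1 / (2 * \<eta>) * indicator (U \<inter> V) y"
        proof -
          have "0 \<le> (\<eta> * cmod (g y) - 1)\<^sup>2 / (2 * \<eta>)" using eta by simp
          also have "\<dots> = \<eta> / 2 * (cmod (g y))\<^sup>2 + 1 / (2 * \<eta>) - cmod (g y)"
            using eta by (simp add: power2_eq_square field_simps)
          finally show ?thesis using eta by (auto split: split_indicator)
        qed
        finally show ?thesis .
      qed
      have W_int: "integrable m (indicat_real (U \<inter> V))"
        by (intro integrable_real_indicator) (auto simp: less_top[symmetric])
      have g_sq: "integrable m (\<lambda>y. (cmod (g y))\<^sup>2)"
        using g by (simp add: square_integrable_def)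
      have "(LINT y:A|m. cnj (g y))
          = (LINT y|m. indicator A y *\<^sub>R cnj (g y) - complex_of_real (f y) * cnj (g y))"
        using orth[OF fc] by (simp add: set_lebesgue_integral_def L2_inner_def
            Bochner_Integration.integral_diff[OF Aint fint])
      also have "cmod \<dots> \<le> (LINT y|m. \<eta> / 2 * (cmod (g y))\<^sup>2 + 1 / (2 * \<eta>) * indicator (U \<inter> V) y)"
        by (intro norm_integral_le_of_norm_le bound
            Bochner_Integration.integrable_diff Aint fint Bochner_Integration.integrable_add
            integrable_mult_right g_sq W_int)
      also have "\<dots> = \<eta> / 2 * N + 1 / (2 * \<eta>) * measure m (U \<inter> V)"
        using g_sq W_int
        by (simp add: N_def sp Bochner_Integration.integral_add integrable_mult_right
            del: times_divide_eq_left)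
      also have "\<dots> \<le> \<eta> / 2 * N + 1 / (2 * \<eta>) * (2 * \<eta>\<^sup>2)"
        using W eta by (intro add_left_mono mult_left_mono) auto
      also have "\<dots> = \<eta> * (N / 2 + 1)"
        using eta by (simp add: power2_eq_square field_simps)
      finally show ?thesis .
    qed
    have "N \<ge> 0" by (simp add: N_def)
    have "cmod (LINT y:A|m. cnj (g y)) \<le> 0"
    proof (rule field_le_epsilon)
      fix e :: real assume "e > 0"
      then show "cmod (LINT y:A|m. cnj (g y)) \<le> 0 + e"
        using small[of "e / (N / 2 + 1)"] \<open>N \<ge> 0\<close> by (simp add: add_nonneg_pos)
    qed
    then show "(LINT y:A|m. cnj (g y)) = 0" by simp
  qed
  then show ?thesis by simp
qed

section \<open>Fourier--Bohr averages along a Folner sequence\<close>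

lemma haar_measure_distr:
  assumes "haar_measure h"
  shows "distr h h ((+) s) = h"
proof (rule measure_eqI)
  have sets: "sets h = sets borel" using assms by (simp add: haar_measure_def radon_measure_def)
  have sp: "space h = UNIV" using sets_eq_imp_space_eq[OF sets] by simp
  have meas: "(+) s \<in> measurable h h"
    unfolding measurable_cong_sets[OF sets sets]
    by (intro borel_measurable_continuous_onI continuous_intros)
  fix S assume "S \<in> sets (distr h h ((+) s))"
  then have S: "S \<in> sets h" by simp
  have "(+) s -` S = (+) (- s) ` S"
    by (force simp: image_iff)
  moreover have "emeasure h ((+) (- s) ` S) = emeasure h S"
    using assms S sets unfolding haar_measure_def by metis
  ultimately show "emeasure (distr h h ((+) s)) S = emeasure h S"
    by (simp only: emeasure_distr[OF meas S] sp Int_UNIV_right)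
qed simp

lemma folner_set_integrable:
  fixes \<psi> :: "'g::{topological_ab_group_add, t2_space} \<Rightarrow> complex"
  assumes h: "haar_measure h" and A: "folner_sequence h A"
    and \<psi>: "continuous_on UNIV \<psi>" "\<And>t. cmod (\<psi> t) \<le> M"
  shows "A n \<in> sets h" "emeasure h (A n) < \<infinity>" "set_integrable h (A n) \<psi>"
proof -
  have sets: "sets h = sets borel" using assms by (simp add: haar_measure_def radon_measure_def)
  then have [measurable]: "\<psi> \<in> borel_measurable h"
    using borel_measurable_continuous_onI[OF \<psi>(1)] measurable_cong_sets by blast
  have "open (A n)" and comp: "compact (closure (A n))" using A by (auto simp: folner_sequence_def)
  then show S: "A n \<in> sets h" by (simp add: sets)
  have "closure (A n) \<in> sets h" by (simp add: sets)
  then have "emeasure h (A n) \<le> emeasure h (closure (A n))"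
    by (intro emeasure_mono closure_subset)
  also have "\<dots> < \<infinity>"
  proof -
    have "\<forall>K. compact K \<longrightarrow> emeasure h K < \<infinity>"
      using h unfolding haar_measure_def radon_measure_def by (elim conjE)
    then show ?thesis using comp by (simp only:)
  qed
  finally show "emeasure h (A n) < \<infinity>" .
  then show "set_integrable h (A n) \<psi>"
    unfolding set_integrable_def
    by (intro integrableI_bounded_set_indicator[where B = M]) (use S \<psi> in auto)
qed

text \<open>Translating the function amounts to translating the set \<open>A n\<close>, and the two integrals then differ
only by the integral of \<open>\<psi>\<close> over the symmetric difference of \<open>A n\<close> and its translate.\<close>

lemma folner_averages_translation_invariant:
  fixes \<psi> :: "'g::{topological_ab_group_add, t2_space} \<Rightarrow> complex"
  assumes h: "haar_measure h" and A: "folner_sequence h A"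
    and \<psi>: "continuous_on UNIV \<psi>" "\<And>t. cmod (\<psi> t) \<le> M"
  shows "(\<lambda>n. (1 / measure h (A n)) *\<^sub>R ((LINT t:A n|h. \<psi> (s + t)) - (LINT t:A n|h. \<psi> t)))
    \<longlonglongrightarrow> 0"
proof (rule Lim_null_comparison[OF always_eventually, rule_format])
  let ?D = "\<lambda>n. (A n - (+) s ` A n) \<union> ((+) s ` A n - A n)"
  show "(\<lambda>n. M * (measure h (?D n) / measure h (A n))) \<longlonglongrightarrow> 0"
    using A by (intro tendsto_mult_right_zero) (simp add: folner_sequence_def)
  fix n
  have sets: "sets h = sets borel" using h by (simp add: haar_measure_def radon_measure_def)
  have sp: "space h = UNIV" using sets_eq_imp_space_eq[OF sets] by simp
  note [measurable] = folner_set_integrable(1)[OF h A \<psi>]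
  have [measurable]: "\<psi> \<in> borel_measurable h"
    using borel_measurable_continuous_onI[OF \<psi>(1)] measurable_cong_sets[OF sets] by blast
  have plus[measurable]: "(+) s \<in> measurable h h" for s
    unfolding measurable_cong_sets[OF sets sets]
    by (intro borel_measurable_continuous_onI continuous_intros)
  have "(+) s ` A n = (+) (- s) -` A n \<inter> space h"
    by (force simp: sp image_iff)
  then have sA[measurable]: "(+) s ` A n \<in> sets h"
    using measurable_sets[OF plus folner_set_integrable(1)[OF h A \<psi>]] by simp
  have fin: "emeasure h (A n) < \<infinity>" by (rule folner_set_integrable(2)[OF h A \<psi>])
  have fin': "emeasure h ((+) s ` A n) < \<infinity>"
    using h fin sA unfolding sets haar_measure_def
    by (metis folner_set_integrable(1)[OF h(1) A \<psi>] sets)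
  have int: "integrable h (\<lambda>t. indicator (A n) t *\<^sub>R \<psi> t)"
    using folner_set_integrable(3)[OF h A \<psi>] by (simp add: set_integrable_def)
  have int': "integrable h (\<lambda>t. indicator ((+) s ` A n) t *\<^sub>R \<psi> t)"
    by (intro integrableI_bounded_set_indicator[where B = M]) (use sA fin' \<psi> in auto)
  have "emeasure h (?D n) \<le> emeasure h (A n \<union> (+) s ` A n)"
    by (intro emeasure_mono) auto
  also have "\<dots> \<le> emeasure h (A n) + emeasure h ((+) s ` A n)"
    by (intro emeasure_subadditive) auto
  also have "\<dots> < \<infinity>" using fin fin' by simp
  finally have finD: "emeasure h (?D n) < \<infinity>" .
  have intD: "integrable h (indicat_real (?D n))"
    by (intro integrable_real_indicator finD) auto
  have "(LINT t:A n|h. \<psi> (s + t)) = (LINT t|h. indicator ((+) s ` A n) (s + t) *\<^sub>R \<psi> (s + t))"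
    unfolding set_lebesgue_integral_def
    by (intro Bochner_Integration.integral_cong) (auto simp: indicator_def image_iff)
  also have "\<dots> = (LINT t|distr h h ((+) s). indicator ((+) s ` A n) t *\<^sub>R \<psi> t)"
    by (intro integral_distr[symmetric] plus) measurable
  finally have shift: "(LINT t:A n|h. \<psi> (s + t)) = (LINT t|h. indicator ((+) s ` A n) t *\<^sub>R \<psi> t)"
    by (simp only: haar_measure_distr[OF h])
  have "norm ((LINT t:A n|h. \<psi> (s + t)) - (LINT t:A n|h. \<psi> t))
      = norm (LINT t|h. indicator ((+) s ` A n) t *\<^sub>R \<psi> t - indicator (A n) t *\<^sub>R \<psi> t)"
    unfolding shift unfolding set_lebesgue_integral_def
    by (simp only: Bochner_Integration.integral_diff[OF int' int])
  also have "\<dots> \<le> (LINT t|h. M * indicat_real (?D n) t)"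
    by (intro norm_integral_le_of_norm_le Bochner_Integration.integrable_diff int int'
        integrable_mult_right intD) (use \<psi>(2) in \<open>auto simp: indicator_def\<close>)
  also have "\<dots> = M * measure h (?D n)"
    by (simp add: sp)
  finally have le: "norm ((LINT t:A n|h. \<psi> (s + t)) - (LINT t:A n|h. \<psi> t)) \<le> M * measure h (?D n)" .
  have "norm ((1 / measure h (A n)) *\<^sub>R ((LINT t:A n|h. \<psi> (s + t)) - (LINT t:A n|h. \<psi> t)))
      = norm ((LINT t:A n|h. \<psi> (s + t)) - (LINT t:A n|h. \<psi> t)) / measure h (A n)"
    by simp
  also have "\<dots> \<le> M * measure h (?D n) / measure h (A n)"
    by (intro divide_right_mono le) simp
  finally show "norm ((1 / measure h (A n)) *\<^sub>R ((LINT t:A n|h. \<psi> (s + t)) - (LINT t:A n|h. \<psi> t)))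
      \<le> M * (measure h (?D n) / measure h (A n))" by simp
qed

lemma dual_groupD:
  assumes "\<xi> \<in> dual_group"
  shows "continuous_on UNIV \<xi>" "cmod (\<xi> t) = 1" "\<xi> (s + t) = \<xi> s * \<xi> t"
  using assms by (auto simp: dual_group_def)

lemma one_in_dual_group: "(\<lambda>_. 1) \<in> dual_group"
  by (simp add: dual_group_def)

lemma fourier_bohr_integrable:
  assumes "haar_measure h" "folner_sequence h A" "\<xi> \<in> dual_group"
    and "continuous_on UNIV \<phi>" "\<And>t. cmod (\<phi> t) \<le> M"
  shows "set_integrable h (A n) (\<lambda>t. \<phi> t * cnj (\<xi> t))"
  using assms dual_groupD[OF assms(3)]
  by (intro folner_set_integrable(3)[where M = M] continuous_intros) (auto simp: norm_mult)

lemma fourier_bohr_average_linear: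
  assumes "haar_measure h" "folner_sequence h A" "\<xi> \<in> dual_group"
    and "continuous_on UNIV \<phi>" "\<And>t. cmod (\<phi> t) \<le> M"
    and "continuous_on UNIV \<phi>'" "\<And>t. cmod (\<phi>' t) \<le> M'"
  shows "fourier_bohr_average h A \<xi> (\<lambda>t. a * \<phi> t + b * \<phi>' t) n
    = a * fourier_bohr_average h A \<xi> \<phi> n + b * fourier_bohr_average h A \<xi> \<phi>' n"
proof -
  note i = fourier_bohr_integrable[OF assms(1-5), of n]
    fourier_bohr_integrable[OF assms(1-3,6,7), of n]
  have "(LINT t:A n|h. (a * \<phi> t + b * \<phi>' t) * cnj (\<xi> t))
      = (LINT t:A n|h. a * (\<phi> t * cnj (\<xi> t)) + b * (\<phi>' t * cnj (\<xi> t)))"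
    by (simp add: algebra_simps)
  also have "\<dots> = a * (LINT t:A n|h. \<phi> t * cnj (\<xi> t)) + b * (LINT t:A n|h. \<phi>' t * cnj (\<xi> t))"
    by (subst set_integral_add(2)) (use i in \<open>auto intro: set_integrable_mult_right\<close>)
  finally show ?thesis
    by (simp add: fourier_bohr_average_def scaleR_add_right)
qed

text \<open>The factor \<open>cnj (\<xi> s)\<close> is the one that makes the integrand of the left average a translate of
the integrand of the right one.\<close>

lemma fourier_bohr_average_twisted_translate:
  assumes h: "haar_measure h" and A: "folner_sequence h A" and \<xi>: "\<xi> \<in> dual_group"
    and \<phi>: "continuous_on UNIV \<phi>" "\<And>t. cmod (\<phi> t) \<le> M"
  shows "(\<lambda>n. fourier_bohr_average h A \<xi> (\<lambda>t. cnj (\<xi> s) * \<phi> (t + s)) n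
      - fourier_bohr_average h A \<xi> \<phi> n) \<longlonglongrightarrow> 0"
proof -
  note d = dual_groupD[OF \<xi>]
  have "(\<lambda>n. (1 / measure h (A n)) *\<^sub>R ((LINT t:A n|h. \<phi> (s + t) * cnj (\<xi> (s + t)))
      - (LINT t:A n|h. \<phi> t * cnj (\<xi> t)))) \<longlonglongrightarrow> 0"
    by (rule folner_averages_translation_invariant[OF h A, where M = M])
      (use \<phi> d in \<open>auto intro!: continuous_intros simp: norm_mult\<close>)
  moreover have "\<phi> (s + t) * cnj (\<xi> (s + t)) = cnj (\<xi> s) * \<phi> (t + s) * cnj (\<xi> t)" for t
    by (simp add: d(3) ac_simps)
  ultimately show ?thesis
    by (simp add: fourier_bohr_average_def scaleR_diff_right)
qed

text \<open>The right side is a \<open>cmod\<close> of a nonnegative number, and is an average for the trivial character,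
so that its limit is known at a generic point.\<close>

lemma norm_fourier_bohr_average_le:
  assumes h: "haar_measure h" and A: "folner_sequence h A" and \<xi>: "\<xi> \<in> dual_group"
    and \<phi>: "continuous_on UNIV \<phi>" "\<And>t. cmod (\<phi> t) \<le> M"
  shows "cmod (fourier_bohr_average h A \<xi> \<phi> n)
    \<le> cmod (fourier_bohr_average h A (\<lambda>_. 1) (\<lambda>t. complex_of_real (cmod (\<phi> t))) n)"
proof -
  have i: "integrable h (\<lambda>t. indicator (A n) t *\<^sub>R (\<phi> t * cnj (\<xi> t)))"
    using fourier_bohr_integrable[OF assms, of n] by (simp add: set_integrable_def)
  have n: "norm (indicator (A n) t *\<^sub>R (\<phi> t * cnj (\<xi> t))) = indicator (A n) t *\<^sub>R cmod (\<phi> t)" for t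
    by (simp add: norm_mult dual_groupD(2)[OF \<xi>])
  have "norm (LINT t:A n|h. \<phi> t * cnj (\<xi> t)) \<le> (LINT t:A n|h. cmod (\<phi> t))"
    using integral_norm_bound[of h "\<lambda>t. indicator (A n) t *\<^sub>R (\<phi> t * cnj (\<xi> t))"]
    by (simp only: n set_lebesgue_integral_def)
  also have "\<dots> = Re (LINT t:A n|h. complex_of_real (cmod (\<phi> t)))"
    by (simp add: set_integral_complex_of_real)
  also have "\<dots> \<le> cmod (LINT t:A n|h. complex_of_real (cmod (\<phi> t)))"
    by (rule complex_Re_le_cmod)
  finally show ?thesis
    by (simp add: fourier_bohr_average_def divide_right_mono)
qed

section \<open>Averages at a Wiener--Wintner point\<close>

locale wiener_wintner_setting =
  fixes h :: "'g::{topological_ab_group_add, t2_space} measure"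
    and act :: "'g \<Rightarrow> 'x::t2_space \<Rightarrow> 'x"
    and m :: "'x measure"
    and A :: "nat \<Rightarrow> 'g set"
    and x :: 'x
    and B :: "('x \<Rightarrow> complex) set"
  assumes haar: "haar_measure h"
    and tds: "topological_dynamical_system act"
    and inv: "invariant_probability_measure act m"
    and folner: "folner_sequence h A"
    and basis: "wiener_wintner_basis h A act m x B"
begin

lemma compact_space: "compact (UNIV :: 'x set)"
  and prob: "prob_space m" and radon: "radon_measure m"
  and act_add: "act (s + t) y = act s (act t y)"
  using tds inv by (auto simp: topological_dynamical_system_def invariant_probability_measure_def)

lemma continuous_act: "continuous_on UNIV (act t)"
  and continuous_orbit: "continuous_on UNIV (\<lambda>t. act t y)"
proof -
  have c: "continuous_on UNIV (\<lambda>p. act (fst p) (snd p))"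
    using tds by (simp add: topological_dynamical_system_def case_prod_beta)
  show "continuous_on UNIV (act t)"
    using continuous_on_compose2[OF c, of UNIV "\<lambda>y. (t, y)"]
      continuous_on_Pair[OF continuous_on_const continuous_on_id, of UNIV t] by simp
  show "continuous_on UNIV (\<lambda>t. act t y)"
    using continuous_on_compose2[OF c, of UNIV "\<lambda>t. (t, y)"]
      continuous_on_Pair[OF continuous_on_id continuous_on_const, of UNIV y] by simp
qed

lemma continuous_along_orbit:
  "continuous_on UNIV f \<Longrightarrow> continuous_on UNIV (\<lambda>t. f (act t x))"
  by (rule continuous_on_compose2[OF _ continuous_orbit]) auto

lemma continuous_square_integrable:
  "continuous_on UNIV f \<Longrightarrow> square_integrable m f"
  by (intro continuous_imp_square_integrable compact_space prob radon)

text \<open>Existence holds because the orthonormal basis of a nonzero space cannot be empty. For uniqueness,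
all basis functions for \<open>\<xi>\<close> have the same inner products with continuous functions, as these are
limits of the same averages; so they coincide in \<open>L\<^sup>2\<close>, where distinct members of the basis are
orthogonal.\<close>

lemma eigenfunction_basis_unique:
  assumes \<xi>: "\<xi> \<in> eigenvalues act m"
  shows "\<exists>!e. e \<in> B \<and> eigenfunction act m \<xi> e"
proof -
  let ?S = "{e \<in> B. eigenfunction act m \<xi> e}"
  have ob: "orthonormal_basis m (eigenspace act m \<xi>) ?S"
    using basis \<xi> by (simp add: wiener_wintner_basis_def)
  obtain g where g: "eigenfunction act m \<xi> g" using \<xi> by (auto simp: eigenvalues_def)
  have gE: "g \<in> eigenspace act m \<xi>" and gnz: "\<not> (AE y in m. g y = 0)"
    using g by (auto simp: eigenfunction_def)
  have gsq: "square_integrable m g" using gE by (simp add: eigenspace_def)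
  have "?S \<noteq> {}"
  proof
    assume empty: "?S = {}"
    have "L2_norm m g < \<delta>" if pos: "\<delta> > 0" for \<delta>
    proof -
      obtain F c where "finite F" "F \<subseteq> ?S" "L2_norm m (\<lambda>x. g x - (\<Sum>e\<in>F. c e * e x)) < \<delta>"
        using ob gE pos unfolding orthonormal_basis_def by meson
      then show ?thesis using empty by simp
    qed
    then have "L2_norm m g \<le> 0" by (meson less_irrefl not_less)
    then have "(LINT y|m. (cmod (g y))\<^sup>2) = 0"
      by (simp add: L2_norm_def order_antisym)
    then have "AE y in m. (cmod (g y))\<^sup>2 = 0"
      using gsq by (subst (asm) integral_nonneg_eq_0_iff_AE) (auto simp: square_integrable_def)
    then show False using gnz by simp
  qed
  moreover have "e = e'" if e: "e \<in> ?S" "e' \<in> ?S" for e e'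
  proof -
    have sq: "square_integrable m e" "square_integrable m e'"
      using e by (auto simp: eigenfunction_def eigenspace_def)
    have same: "L2_inner m f e = L2_inner m f e'" if f: "continuous_on UNIV f" for f
    proof -
      have "fourier_bohr_average h A \<xi> (\<lambda>t. f (act t x)) \<longlonglongrightarrow> L2_inner m f e"
        "fourier_bohr_average h A \<xi> (\<lambda>t. f (act t x)) \<longlonglongrightarrow> L2_inner m f e'"
        using basis e \<xi> f unfolding wiener_wintner_basis_def by blast+
      then show ?thesis by (rule LIMSEQ_unique)
    qed
    have "AE y in m. e y - e' y = 0"
    proof (rule AE_zero_of_orthogonal_to_continuous[OF compact_space prob radon])
      show "square_integrable m (\<lambda>y. e y - e' y)" by (intro square_integrable_diff sq)
      fix f :: "'x \<Rightarrow> complex" assume f: "continuous_on UNIV f"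
      show "L2_inner m f (\<lambda>y. e y - e' y) = 0"
        using same[OF f] sq[THEN square_integrable_mult_integrable[OF continuous_square_integrable[OF f]]]
        by (simp add: L2_inner_def right_diff_distrib)
    qed
    moreover have [measurable]: "e \<in> borel_measurable m" "e' \<in> borel_measurable m"
      using sq by (auto simp: square_integrable_def)
    ultimately have "L2_inner m e e' = L2_inner m e e"
      using square_integrable_mult_integrable[OF sq(1) sq(1)]
        square_integrable_mult_integrable[OF sq(1) sq(2)]
      unfolding L2_inner_def
      by (intro integral_cong_AE) (auto intro: borel_measurable_integrable)
    moreover have "L2_inner m e e = 1" "L2_inner m e e' = (if e = e' then 1 else 0)"
      using ob e by (simp_all add: orthonormal_basis_def)
    ultimately show ?thesis by (simp split: if_splits)
  qed
  ultimately show ?thesis by blast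
qed

lemma basis_eigenfunction:
  assumes "\<xi> \<in> eigenvalues act m"
  shows "basis_eigenfunction act m B \<xi> \<in> B" "eigenfunction act m \<xi> (basis_eigenfunction act m B \<xi>)"
  using theI'[OF eigenfunction_basis_unique[OF assms]] by (simp_all add: basis_eigenfunction_def)

lemma tendsto_eigenvalue:
  assumes "\<xi> \<in> eigenvalues act m" "continuous_on UNIV f"
  shows "fourier_bohr_average h A \<xi> (\<lambda>t. f (act t x))
    \<longlonglongrightarrow> L2_inner m f (basis_eigenfunction act m B \<xi>)"
  using basis basis_eigenfunction[OF assms(1)] assms unfolding wiener_wintner_basis_def by blast

text \<open>Genericity of \<open>x\<close>: the basis function \<open>e\<close> of the trivial character is \<open>1\<close> almost everywhere,
since \<open>\<parallel>e - 1\<parallel>\<^sup>2 = \<parallel>e\<parallel>\<^sup>2 - 2 * Re \<langle>1, e\<rangle> + 1 = 0\<close>, where \<open>\<langle>1, e\<rangle> = 1\<close> comes from averaging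
the constant function \<open>1\<close>.\<close>

lemma averages_tendsto_integral:
  assumes f: "continuous_on UNIV f"
  shows "fourier_bohr_average h A (\<lambda>_. 1) (\<lambda>t. f (act t x)) \<longlonglongrightarrow> (LINT y|m. f y)"
proof -
  interpret prob_space m by (rule prob)
  have one_sq: "square_integrable m (\<lambda>_. 1)" by (simp add: square_integrable_def)
  have "eigenfunction act m (\<lambda>_. 1) (\<lambda>_. 1)"
    using one_sq by (simp add: eigenfunction_def eigenspace_def)
  then have ev: "(\<lambda>_. 1) \<in> eigenvalues act m"
    by (auto simp: eigenvalues_def one_in_dual_group)
  define e where "e = basis_eigenfunction act m B (\<lambda>_. 1)"
  have eB: "e \<in> B" "eigenfunction act m (\<lambda>_. 1) e"
    using basis_eigenfunction[OF ev] by (simp_all add: e_def)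
  have sq: "square_integrable m e" using eB by (simp add: eigenfunction_def eigenspace_def)
  have [measurable]: "e \<in> borel_measurable m" using sq by (simp add: square_integrable_def)
  have e_int: "integrable m (\<lambda>y. cnj (e y))"
    using square_integrable_mult_integrable[OF one_sq sq] by simp
  have "orthonormal_basis m (eigenspace act m (\<lambda>_. 1)) {e \<in> B. eigenfunction act m (\<lambda>_. 1) e}"
    using basis ev by (simp add: wiener_wintner_basis_def)
  then have "L2_inner m e e = 1" using eB by (auto simp: orthonormal_basis_def)
  moreover have "L2_inner m e e = complex_of_real (LINT y|m. (cmod (e y))\<^sup>2)"
    unfolding L2_inner_def complex_norm_square[symmetric] by (rule integral_complex_of_real)
  ultimately have norm_e: "(LINT y|m. (cmod (e y))\<^sup>2) = 1" by (simp only: of_real_eq_1_iff)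
  have avg_one: "fourier_bohr_average h A (\<lambda>_. 1) (\<lambda>t. 1) n = 1" for n
  proof -
    have pos: "measure h (A n) > 0" using folner by (simp add: folner_sequence_def)
    have "A n \<in> sets h" "emeasure h (A n) < \<infinity>"
      using folner_set_integrable(1,2)[OF haar folner continuous_on_const, of 1 1] by auto
    then have "(LINT t:A n|h. (1::complex)) = measure h (A n) *\<^sub>R 1"
      unfolding set_lebesgue_integral_def
      by (subst integral_scaleR_left) auto
    then show ?thesis using pos by (simp add: fourier_bohr_average_def)
  qed
  have "fourier_bohr_average h A (\<lambda>_. 1) (\<lambda>t. 1) \<longlonglongrightarrow> L2_inner m (\<lambda>_. 1) e"
    using tendsto_eigenvalue[OF ev, of "\<lambda>_. 1"] by (simp add: e_def)
  moreover have "fourier_bohr_average h A (\<lambda>_. 1) (\<lambda>t. 1) \<longlonglongrightarrow> 1"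
    by (rule tendsto_eventually) (simp add: avg_one)
  ultimately have "L2_inner m (\<lambda>_. 1) e = 1" by (rule LIMSEQ_unique)
  then have int_e: "(LINT y|m. e y) = 1"
    by (simp add: L2_inner_def)
  have Re_int: "integrable m (\<lambda>y. Re (e y))" "(LINT y|m. Re (e y)) = 1"
    using e_int int_e by auto
  have "(cmod (z - 1))\<^sup>2 = (cmod z)\<^sup>2 - 2 * Re z + 1" for z
    unfolding cmod_power2 by (simp add: power2_eq_square algebra_simps)
  then have "(LINT y|m. (cmod (e y - 1))\<^sup>2) = (LINT y|m. (cmod (e y))\<^sup>2 - 2 * Re (e y) + 1)"
    by simp
  also have "\<dots> = 0"
    using sq Re_int norm_e by (simp add: square_integrable_def prob_space)
  finally have "AE y in m. (cmod (e y - 1))\<^sup>2 = 0"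
    using square_integrable_diff[OF sq one_sq]
    by (subst (asm) integral_nonneg_eq_0_iff_AE) (auto simp: square_integrable_def)
  then have e1: "AE y in m. e y = 1" by eventually_elim simp
  have "L2_inner m f e = (LINT y|m. f y)"
    unfolding L2_inner_def
  proof (rule integral_cong_AE)
    show "(\<lambda>y. f y * cnj (e y)) \<in> borel_measurable m"
      using square_integrable_mult_integrable[OF continuous_square_integrable[OF f] sq]
      by (rule borel_measurable_integrable)
    show "f \<in> borel_measurable m"
      using continuous_square_integrable[OF f] by (simp add: square_integrable_def)
    show "AE y in m. f y * cnj (e y) = f y" using e1 by eventually_elim simp
  qed
  then show ?thesis using tendsto_eigenvalue[OF ev f] by (simp add: e_def)
qed

text \<open>Replacing \<open>f\<close> by another element of the set \<open>C\<close> defined below leaves the limiting behaviour of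
the averages unchanged. Since \<open>\<xi>\<close> is not an eigenvalue, the element can be taken as small in
\<open>L\<^sup>2\<close> as desired, and genericity of \<open>x\<close> bounds its averages by its \<open>L\<^sup>1\<close>-norm.\<close>

lemma tendsto_non_eigenvalue:
  assumes \<xi>: "\<xi> \<in> dual_group" and not_ev: "\<xi> \<notin> eigenvalues act m" and f: "continuous_on UNIV f"
  shows "fourier_bohr_average h A \<xi> (\<lambda>t. f (act t x)) \<longlonglongrightarrow> 0"
proof -
  interpret prob_space m by (rule prob)
  define av where "av g = fourier_bohr_average h A \<xi> (\<lambda>t. g (act t x))" for g
  have linear: "av (\<lambda>y. a * g y + b * g' y) n = a * av g n + b * av g' n"
    if g: "continuous_on UNIV g" "continuous_on UNIV g'" for a b g g' n
  proof -
    obtain M M' where "\<And>y. cmod (g y) \<le> M" "\<And>y. cmod (g' y) \<le> M'"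
      using g continuous_on_compact_UNIV_bounded[OF compact_space] by metis
    then show ?thesis
      unfolding av_def using g
      by (intro fourier_bohr_average_linear[OF haar folner \<xi>] continuous_along_orbit)
  qed
  define C where "C = {g. continuous_on UNIV g \<and> (\<lambda>n. av g n - av f n) \<longlonglongrightarrow> 0}"
  have small: "\<exists>g\<in>C. (LINT y|m. (cmod (g y))\<^sup>2) < d" if "d > 0" for d
  proof (rule ccontr)
    assume "\<not> ?thesis"
    then have far: "\<And>g. g \<in> C \<Longrightarrow> d \<le> (LINT y|m. (cmod (g y))\<^sup>2)" by force
    have "\<exists>g. eigenfunction act m \<xi> g"
    proof (rule eigenfunction_of_positive_distance[OF inv continuous_act dual_groupD(2)[OF \<xi>] _ _ _ _ that far])
      show "C \<noteq> {}" using f by (auto simp: C_def)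
      show "square_integrable m g" if "g \<in> C" for g
        using that by (simp add: C_def continuous_square_integrable)
      show "(\<lambda>y. (g y + g' y) / 2) \<in> C" if g: "g \<in> C" "g' \<in> C" for g g'
      proof -
        have c: "continuous_on UNIV g" "continuous_on UNIV g'"
          and l: "(\<lambda>n. av g n - av f n) \<longlonglongrightarrow> 0" "(\<lambda>n. av g' n - av f n) \<longlonglongrightarrow> 0"
          using g by (auto simp: C_def)
        have mid: "av (\<lambda>y. (g y + g' y) / 2) n = av g n / 2 + av g' n / 2" for n
          using linear[OF c, of "1/2" "1/2" n] by (simp add: add_divide_distrib)
        have eq: "(1/2) * (av g n - av f n) + (1/2) * (av g' n - av f n)
            = av (\<lambda>y. (g y + g' y) / 2) n - av f n" for n
          unfolding mid by (simp add: field_simps)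
        have "(\<lambda>n. (1/2) * (av g n - av f n) + (1/2) * (av g' n - av f n)) \<longlonglongrightarrow> (1/2) * 0 + (1/2) * 0"
          by (intro tendsto_intros l)
        then have "(\<lambda>n. av (\<lambda>y. (g y + g' y) / 2) n - av f n) \<longlonglongrightarrow> 0"
          unfolding eq by simp
        then show ?thesis using c by (auto simp: C_def intro!: continuous_intros)
      qed
      show "(\<lambda>y. cnj (\<xi> s) * g (act s y)) \<in> C" if g: "g \<in> C" for g s
      proof -
        have c: "continuous_on UNIV g" and l: "(\<lambda>n. av g n - av f n) \<longlonglongrightarrow> 0"
          using g by (auto simp: C_def)
        obtain M where M: "\<And>y. cmod (g y) \<le> M"
          using c continuous_on_compact_UNIV_bounded[OF compact_space] by metis
        have "(\<lambda>n. av (\<lambda>y. cnj (\<xi> s) * g (act s y)) n - av g n) \<longlonglongrightarrow> 0"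
          using fourier_bohr_average_twisted_translate[OF haar folner \<xi> continuous_along_orbit[OF c] M, of s]
          by (simp add: av_def act_add[symmetric] add.commute)
        from tendsto_add[OF this l]
        have "(\<lambda>n. av (\<lambda>y. cnj (\<xi> s) * g (act s y)) n - av f n) \<longlonglongrightarrow> 0" by simp
        moreover have "continuous_on UNIV (\<lambda>y. g (act s y))"
          by (rule continuous_on_compose2[OF c continuous_act]) auto
        ultimately show ?thesis by (auto simp: C_def intro!: continuous_intros)
      qed
    qed
    then show False using not_ev \<xi> by (simp add: eigenvalues_def)
  qed
  have "av f \<longlonglongrightarrow> 0"
  proof (rule LIMSEQ_I)
    fix r :: real assume "r > 0"
    define d where "d = r / 3"
    have d: "d > 0" using \<open>r > 0\<close> by (simp add: d_def)
    obtain g where g: "g \<in> C" "(LINT y|m. (cmod (g y))\<^sup>2) < d\<^sup>2"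
      using small[of "d\<^sup>2"] d by auto
    have c: "continuous_on UNIV g" and l: "(\<lambda>n. av g n - av f n) \<longlonglongrightarrow> 0"
      using g by (auto simp: C_def)
    obtain M where M: "\<And>y. cmod (g y) \<le> M"
      using c continuous_on_compact_UNIV_bounded[OF compact_space] by metis
    have gsq: "square_integrable m g" by (rule continuous_square_integrable[OF c])
    have cn: "continuous_on UNIV (\<lambda>y. complex_of_real (cmod (g y)))"
      by (intro continuous_intros c)
    \<comment> \<open>The arithmetic-geometric mean inequality, to pass from the \<open>L\<^sup>2\<close>-bound to an \<open>L\<^sup>1\<close>-bound.\<close>
    have bound: "cmod (g y) \<le> ((cmod (g y))\<^sup>2 / d + d) / 2" for y
    proof -
      have "0 \<le> (cmod (g y) - d)\<^sup>2 / d" using d by simp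
      also have "\<dots> = (cmod (g y))\<^sup>2 / d + d - 2 * cmod (g y)"
        using d by (simp add: power2_eq_square field_simps)
      finally show ?thesis by simp
    qed
    have g2: "integrable m (\<lambda>y. (cmod (g y))\<^sup>2)" and [measurable]: "g \<in> borel_measurable m"
      using gsq by (auto simp: square_integrable_def)
    have "(LINT y|m. cmod (g y)) \<le> (LINT y|m. ((cmod (g y))\<^sup>2 / d + d) / 2)"
    proof (intro integral_mono bound)
      show "integrable m (\<lambda>y. cmod (g y))"
        by (rule integrable_const_bound[where B = M]) (use M in auto)
      show "integrable m (\<lambda>y. ((cmod (g y))\<^sup>2 / d + d) / 2)"
        using g2 by simp
    qed
    also have "\<dots> = ((LINT y|m. (cmod (g y))\<^sup>2) / d + d) / 2"
      using g2 by (simp add: prob_space)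
    also have "\<dots> < (d\<^sup>2 / d + d) / 2"
      using g(2) d by (simp add: divide_strict_right_mono)
    finally have int_g: "(LINT y|m. cmod (g y)) < d" using d by (simp add: power2_eq_square)
    have "(\<lambda>n. cmod (fourier_bohr_average h A (\<lambda>_. 1) (\<lambda>t. complex_of_real (cmod (g (act t x)))) n))
        \<longlonglongrightarrow> cmod (LINT y|m. complex_of_real (cmod (g y)))"
      by (intro tendsto_norm averages_tendsto_integral cn)
    then have "eventually (\<lambda>n. cmod (fourier_bohr_average h A (\<lambda>_. 1)
        (\<lambda>t. complex_of_real (cmod (g (act t x)))) n) < d) sequentially"
      by (rule order_tendstoD) (use int_g in \<open>simp add: abs_of_nonneg\<close>)
    moreover have "eventually (\<lambda>n. cmod (av g n - av f n) < d) sequentially"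
      using tendstoD[OF l d] by (simp add: dist_norm)
    ultimately have "eventually (\<lambda>n. cmod (av f n) < r) sequentially"
    proof eventually_elim
      case (elim n)
      have "cmod (av g n) < d"
        using norm_fourier_bohr_average_le[OF haar folner \<xi> continuous_along_orbit[OF c] M, of n] elim(1)
        unfolding av_def by linarith
      then have "cmod (av f n) < 2 * d"
        using norm_triangle_ineq4[of "av g n" "av g n - av f n"] elim(2) by simp
      then show ?case using d by (simp add: d_def)
    qed
    then show "\<exists>no. \<forall>n\<ge>no. norm (av f n - 0) < r" by (simp add: eventually_sequentially)
  qed
  then show ?thesis by (simp add: av_def)
qed

end

theorem theorem5p6:
  fixes h :: "'g::{topological_ab_group_add, t2_space} measure"
    and act :: "'g \<Rightarrow> 'x::t2_space \<Rightarrow> 'x"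
    and m :: "'x measure"
    and A :: "nat \<Rightarrow> 'g set"
    and x :: 'x
    and B :: "('x \<Rightarrow> complex) set"
  assumes "locally_compact_space (euclidean :: 'g topology)"
    and "sigma_compact (UNIV :: 'g set)"
    and "haar_measure h"
    and "topological_dynamical_system act"
    and "invariant_probability_measure act m"
    and "folner_sequence h A"
    and "wiener_wintner_point h A act m x"
    and "wiener_wintner_basis h A act m x B"
  shows "\<forall>f :: 'x \<Rightarrow> complex. continuous_on UNIV f \<longrightarrow>
    (\<forall>\<xi> \<in> dual_group.
       fourier_bohr_exists h A \<xi> (\<lambda>t. f (act t x)) \<and>
       fourier_bohr_coefficient h A \<xi> (\<lambda>t. f (act t x)) =
         (if \<xi> \<in> eigenvalues act m then L2_inner m f (basis_eigenfunction act m B \<xi>) else 0))"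
proof (intro allI impI ballI)
  fix f :: "'x \<Rightarrow> complex" and \<xi> :: "'g \<Rightarrow> complex"
  assume f: "continuous_on UNIV f" and \<xi>: "\<xi> \<in> dual_group"
  interpret wiener_wintner_setting h act m A x B
    by unfold_locales (fact assms)+
  have "fourier_bohr_average h A \<xi> (\<lambda>t. f (act t x)) \<longlonglongrightarrow>
      (if \<xi> \<in> eigenvalues act m then L2_inner m f (basis_eigenfunction act m B \<xi>) else 0)"
    using tendsto_eigenvalue[OF _ f] tendsto_non_eigenvalue[OF \<xi> _ f] by simp
  then show "fourier_bohr_exists h A \<xi> (\<lambda>t. f (act t x)) \<and>
       fourier_bohr_coefficient h A \<xi> (\<lambda>t. f (act t x)) =
         (if \<xi> \<in> eigenvalues act m then L2_inner m f (basis_eigenfunction act m B \<xi>) else 0)"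
    unfolding fourier_bohr_exists_def fourier_bohr_coefficient_def
    by (auto intro: convergentI limI)
qed

end
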